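(* Suppose that assumptions (FS1), (FS2), (SS1) and (VA1) (written out in the context) hold. Then, along the asymptotic sequence described in the context, $$V_1(\hat\tau_\rho)=O\left(\frac{A^2}{n_I}\right),\qquad V_2(\hat\tau_\rho)=O\left(\frac{A^2}{n_I\,n_{II0}}\right),\qquad V_3(\hat\tau_\rho)=O\left(\frac{A^2}{N_I\,n_{II0}}\right).$$
   Context: Setting. $\mathcal F\subset\mathbb R^d$ is a fixed bounded measurable set of Lebesgue measure $A>0$, and $\rho:\mathcal F\to\mathbb R$ is Lebesgue integrable, with $\tau_\rho=\int_{\mathcal F}\rho(x)\,dx$. We consider a sequence (index suppressed) of partitions of $\mathcal F$ into $N_I$ disjoint measurable sub-regions (primary sampling units, PSUs) forming $U_I=\{u_1,\dots,u_{N_I}\}$; $A_i$ is the measure of $u_i$. Asymptotics: $A$ is fixed, $N_I\to\infty$, the partition becomes increasingly fine (PSU diameters shrink to $0$), and $n_I\to\infty$. Constants in the assumptions do not depend on the position in the sequence; $O(\cdot)$ is along this sequence. Sampling. First stage: a random sample $S_I\subset U_I$ of size $n_I$ is selected; $I_{Ii}$ is the indicator of $u_i\in S_I$, $\pi_{Ii}=E(I_{Ii})$, $\pi_{Iij}=E(I_{Ii}I_{Ij})$ (so $\pi_{Iii}=\pi_{Ii}$), $\Delta_{Iij}=\pi_{Iij}-\pi_{Ii}\pi_{Ij}$. Second stage: conditionally on $S_I$, for each $u_i\in S_I$ a sample $S_{IIi}$ of $n_{IIi}$ points is drawn independently from a probability density $f_{IIi}$ supported on $u_i$; the second-stage mechanism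 does not depend on the realization of $S_I$, and the samples $S_{IIi}$ are conditionally independent across PSUs given $S_I$. Put $\pi_{IIi}(x)=n_{IIi}f_{IIi}(x)$ and $n_{II0}=N_I^{-1}\sum_{i=1}^{N_I}n_{IIi}$. Estimator. $\tau_{\rho i}=\int_{u_i}\rho(x)\,dx$, $\hat\tau_{\rho i}=\sum_{x\in S_{IIi}}\rho(x)/\pi_{IIi}(x)$, $\hat\tau_\rho=\sum_{u_i\in S_I}\hat\tau_{\rho i}/\pi_{Ii}$. Its variance decomposes as $V(\hat\tau_\rho)=V_1(\hat\tau_\rho)+V_2(\hat\tau_\rho)+V_3(\hat\tau_\rho)$ with $$V_1(\hat\tau_\rho)=\sum_{u_i\in U_I}\sum_{u_j\in U_I}\Delta_{Iij}\frac{\tau_{\rho i}}{\pi_{Ii}}\frac{\tau_{\rho j}}{\pi_{Ij}},\quad V_2(\hat\tau_\rho)=\sum_{u_i\in U_I}\frac{1-\pi_{Ii}}{\pi_{Ii}}V_i,\quad V_3(\hat\tau_\rho)=\sum_{u_i\in U_I}V_i,$$ $$V_i=\int_{u_i}\pi_{IIi}(x)\left\{\frac{\rho(x)}{\pi_{IIi}(x)}-\frac{\tau_{\rho i}}{n_{IIi}}\right\}^2dx.$$ Assumptions. (FS1) There exist constants $f_{I0}<1$ and $0<c_{I1}\le C_{I1}<\infty$ with $n_I/N_I\le f_{I0}$ and $c_{I1}\le (N_I/n_I)\pi_{Ii}\le C_{I1}$ for all $i$. (FS2) There exist constants $C_{I2},C_{I3},C_{I4}>0$ such that, the maxima being over distinct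 indices in $\{1,\dots,N_I\}$, $\Delta_{I2}=\max|E\{(I_{Ii}-\pi_{Ii})(I_{Ij}-\pi_{Ij})\}|\le C_{I2}N_I^{-2}n_I$, $\Delta_{I3}=\max|E\{(I_{Ii}-\pi_{Ii})(I_{Ij}-\pi_{Ij})(I_{Ii'}-\pi_{Ii'})\}|\le C_{I3}N_I^{-3}n_I^2$, $\Delta_{I4}=\max|E\{(I_{Ii}-\pi_{Ii})(I_{Ij}-\pi_{Ij})(I_{Ii'}-\pi_{Ii'})(I_{Ij'}-\pi_{Ij'})\}|\le C_{I4}N_I^{-4}n_I^2$. (SS1) There exist constants $0<\lambda_1\le\Lambda_1<\infty$, $0<\phi_1\le\Phi_1<\infty$, $0<c_1\le C_1<\infty$ such that for every PSU $u_i$: $\lambda_1n_{II0}\le n_{IIi}\le\Lambda_1n_{II0}$; $\phi_1A/N_I\le A_i\le\Phi_1A/N_I$; $c_1/A_i\le f_{IIi}(x)\le C_1/A_i$ for all $x\in u_i$; and $n_{IIi}\ge2$. (VA1) There exist constants $m_1,M_1$ such that $A^{-1}\int_{\mathcal F}\rho(x)^4dx\le M_1$ and $|A^{-1}\int_{\mathcal F}\rho(x)\,dx|\ge m_1>0$. *)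

theory Defs
  imports "HOL-Probability.Probability"
begin

text \<open>
  One member of the asymptotic sequence: a partition of the population into primary sampling units
  together with a two-stage sample, realised on the probability space \<open>prob_sp\<close>. Units are
  indexed by \<open>{1..num_psu}\<close>, so the first-stage sample \<open>sample1\<close> is a random set of
  indices. The \<open>j\<close>-th point drawn in unit \<open>i\<close> is \<open>sample2 i j\<close>, for
  \<open>j \<in> {1..size2 i}\<close>; it is meaningful only on the event that \<open>i\<close> is selected.
\<close>

record ('w, 'a) two_stage =
  num_psu :: nat
  psu :: "nat \<Rightarrow> 'a set"
  prob_sp :: "'w measure"
  size1 :: nat
  sample1 :: "'w \<Rightarrow> nat set"
  size2 :: "nat \<Rightarrow> nat"
  dens2 :: "nat \<Rightarrow> 'a \<Rightarrow> real"
  sample2 :: "nat \<Rightarrow> nat \<Rightarrow> 'w \<Rightarrow> 'a"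

definition psu_partition :: "'a set \<Rightarrow> ('w, 'a::euclidean_space) two_stage \<Rightarrow> bool" where
  "psu_partition F D \<longleftrightarrow>
     disjoint_family_on (psu D) {1..num_psu D} \<and>
     (\<Union>i\<in>{1..num_psu D}. psu D i) = F \<and>
     (\<forall>i\<in>{1..num_psu D}. psu D i \<in> sets lebesgue)"

definition first_stage :: "('w, 'a::euclidean_space) two_stage \<Rightarrow> bool" where
  "first_stage D \<longleftrightarrow>
     prob_space (prob_sp D) \<and>
     sample1 D \<in> measurable (prob_sp D) (count_space (Pow {1..num_psu D})) \<and>
     (\<forall>\<omega>\<in>space (prob_sp D). card (sample1 D \<omega>) = size1 D)"

text \<open>
  The last conjunct says that, conditionally on \<open>sample1 D = s\<close>, the points drawn in the
  selected units are independent (within and across units) and those of unit \<open>i\<close> have density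
  \<open>dens2 D i\<close>. Neither the densities nor the sizes depend on \<open>s\<close>.
\<close>

definition second_stage :: "('w, 'a::euclidean_space) two_stage \<Rightarrow> bool" where
  "second_stage D \<longleftrightarrow>
     (\<forall>i\<in>{1..num_psu D}.
        dens2 D i \<in> borel_measurable lebesgue \<and>
        (\<forall>x. 0 \<le> dens2 D i x) \<and>
        (\<forall>x. x \<notin> psu D i \<longrightarrow> dens2 D i x = 0) \<and>
        integrable lebesgue (dens2 D i) \<and>
        (LINT x|lebesgue. dens2 D i x) = 1) \<and>
     (\<forall>i\<in>{1..num_psu D}. \<forall>j\<in>{1..size2 D i}.
        sample2 D i j \<in> measurable (prob_sp D) lebesgue) \<and>
     (\<forall>s E. s \<subseteq> {1..num_psu D} \<longrightarrow>
        (\<forall>i\<in>s. \<forall>j\<in>{1..size2 D i}. E i j \<in> sets lebesgue) \<longrightarrow>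
        measure (prob_sp D) {\<omega> \<in> space (prob_sp D). sample1 D \<omega> = s \<and>
            (\<forall>i\<in>s. \<forall>j\<in>{1..size2 D i}. sample2 D i j \<omega> \<in> E i j)}
        = measure (prob_sp D) {\<omega> \<in> space (prob_sp D). sample1 D \<omega> = s} *
          (\<Prod>i\<in>s. \<Prod>j\<in>{1..size2 D i}. LINT x:E i j|lebesgue. dens2 D i x))"

definition ind1 :: "('w, 'a) two_stage \<Rightarrow> nat \<Rightarrow> 'w \<Rightarrow> real" where
  "ind1 D i \<omega> = (if i \<in> sample1 D \<omega> then 1 else 0)"

definition pi1 :: "('w, 'a) two_stage \<Rightarrow> nat \<Rightarrow> real" where
  "pi1 D i = (LINT \<omega>|prob_sp D. ind1 D i \<omega>)"

definition pi1_joint :: "('w, 'a) two_stage \<Rightarrow> nat \<Rightarrow> nat \<Rightarrow> real" where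
  "pi1_joint D i j = (LINT \<omega>|prob_sp D. ind1 D i \<omega> * ind1 D j \<omega>)"

definition Delta1 :: "('w, 'a) two_stage \<Rightarrow> nat \<Rightarrow> nat \<Rightarrow> real" where
  "Delta1 D i j = pi1_joint D i j - pi1 D i * pi1 D j"

text \<open>
  \<open>max_moment D p\<close> is the largest absolute central mixed moment of the inclusion indicators of
  \<open>p\<close> distinct units. Such a moment is symmetric in the units, so a \<open>p\<close>-tuple of distinct
  indices is represented by the set of its entries. Inserting 0 only fixes the value when there
  are fewer than \<open>p\<close> units.
\<close>

definition max_moment :: "('w, 'a) two_stage \<Rightarrow> nat \<Rightarrow> real" where
  "max_moment D p =
     Max (insert 0 ((\<lambda>J. \<bar>LINT \<omega>|prob_sp D. (\<Prod>i\<in>J. ind1 D i \<omega> - pi1 D i)\<bar>) `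
       {J. J \<subseteq> {1..num_psu D} \<and> card J = p}))"

definition pi2 :: "('w, 'a) two_stage \<Rightarrow> nat \<Rightarrow> 'a \<Rightarrow> real" where
  "pi2 D i x = real (size2 D i) * dens2 D i x"

definition mean_size2 :: "('w, 'a) two_stage \<Rightarrow> real" where
  "mean_size2 D = (\<Sum>i\<in>{1..num_psu D}. real (size2 D i)) / real (num_psu D)"

definition tau_psu :: "('a::euclidean_space \<Rightarrow> real) \<Rightarrow> ('w, 'a) two_stage \<Rightarrow> nat \<Rightarrow> real" where
  "tau_psu \<rho> D i = (LINT x:psu D i|lebesgue. \<rho> x)"

definition tau_psu_hat :: "('a \<Rightarrow> real) \<Rightarrow> ('w, 'a) two_stage \<Rightarrow> nat \<Rightarrow> 'w \<Rightarrow> real" where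
  "tau_psu_hat \<rho> D i \<omega> =
     (\<Sum>j\<in>{1..size2 D i}. \<rho> (sample2 D i j \<omega>) / pi2 D i (sample2 D i j \<omega>))"

definition tau_hat :: "('a \<Rightarrow> real) \<Rightarrow> ('w, 'a) two_stage \<Rightarrow> 'w \<Rightarrow> real" where
  "tau_hat \<rho> D \<omega> = (\<Sum>i\<in>sample1 D \<omega>. tau_psu_hat \<rho> D i \<omega> / pi1 D i)"

text \<open>
  \<open>V_psu \<rho> D i\<close> is the second-stage variance of \<open>tau_psu_hat \<rho> D i\<close>; \<open>V1\<close>, \<open>V2\<close> and
  \<open>V3\<close> are the terms of the decomposition of the variance of \<open>tau_hat \<rho> D\<close>.
\<close>

definition V_psu :: "('a::euclidean_space \<Rightarrow> real) \<Rightarrow> ('w, 'a) two_stage \<Rightarrow> nat \<Rightarrow> real" where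
  "V_psu \<rho> D i =
     (LINT x:psu D i|lebesgue.
        pi2 D i x * (\<rho> x / pi2 D i x - tau_psu \<rho> D i / real (size2 D i))\<^sup>2)"

definition V1 :: "('a::euclidean_space \<Rightarrow> real) \<Rightarrow> ('w, 'a) two_stage \<Rightarrow> real" where
  "V1 \<rho> D =
     (\<Sum>i\<in>{1..num_psu D}. \<Sum>j\<in>{1..num_psu D}.
        Delta1 D i j * (tau_psu \<rho> D i / pi1 D i) * (tau_psu \<rho> D j / pi1 D j))"

definition V2 :: "('a::euclidean_space \<Rightarrow> real) \<Rightarrow> ('w, 'a) two_stage \<Rightarrow> real" where
  "V2 \<rho> D = (\<Sum>i\<in>{1..num_psu D}. (1 - pi1 D i) / pi1 D i * V_psu \<rho> D i)"

definition V3 :: "('a::euclidean_space \<Rightarrow> real) \<Rightarrow> ('w, 'a) two_stage \<Rightarrow> real" where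
  "V3 \<rho> D = (\<Sum>i\<in>{1..num_psu D}. V_psu \<rho> D i)"

definition asymptotic_sequence ::
    "'a::euclidean_space set \<Rightarrow> (nat \<Rightarrow> ('w, 'a) two_stage) \<Rightarrow> bool" where
  "asymptotic_sequence F D \<longleftrightarrow>
     (\<forall>k. psu_partition F (D k) \<and> first_stage (D k) \<and> second_stage (D k)) \<and>
     filterlim (\<lambda>k. num_psu (D k)) at_top sequentially \<and>
     filterlim (\<lambda>k. size1 (D k)) at_top sequentially \<and>
     (\<lambda>k. MAX i\<in>{1..num_psu (D k)}. diameter (psu (D k) i)) \<longlonglongrightarrow> 0"

definition FS1 :: "(nat \<Rightarrow> ('w, 'a) two_stage) \<Rightarrow> bool" where
  "FS1 D \<longleftrightarrow>
     (\<exists>f0 c C. f0 < 1 \<and> 0 < c \<and> c \<le> C \<and>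
        (\<forall>k. real (size1 (D k)) / real (num_psu (D k)) \<le> f0 \<and>
          (\<forall>i\<in>{1..num_psu (D k)}.
             c \<le> real (num_psu (D k)) / real (size1 (D k)) * pi1 (D k) i \<and>
             real (num_psu (D k)) / real (size1 (D k)) * pi1 (D k) i \<le> C)))"

definition FS2 :: "(nat \<Rightarrow> ('w, 'a) two_stage) \<Rightarrow> bool" where
  "FS2 D \<longleftrightarrow>
     (\<exists>C2 C3 C4. 0 < C2 \<and> 0 < C3 \<and> 0 < C4 \<and>
        (\<forall>k. max_moment (D k) 2 \<le> C2 * real (size1 (D k)) / real (num_psu (D k)) ^ 2 \<and>
             max_moment (D k) 3 \<le> C3 * real (size1 (D k)) ^ 2 / real (num_psu (D k)) ^ 3 \<and>
             max_moment (D k) 4 \<le> C4 * real (size1 (D k)) ^ 2 / real (num_psu (D k)) ^ 4))"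

definition SS1 :: "'a::euclidean_space set \<Rightarrow> (nat \<Rightarrow> ('w, 'a) two_stage) \<Rightarrow> bool" where
  "SS1 F D \<longleftrightarrow>
     (\<exists>l1 L1 p1 P1 c1 C1.
        0 < l1 \<and> l1 \<le> L1 \<and> 0 < p1 \<and> p1 \<le> P1 \<and> 0 < c1 \<and> c1 \<le> C1 \<and>
        (\<forall>k. \<forall>i\<in>{1..num_psu (D k)}.
           l1 * mean_size2 (D k) \<le> real (size2 (D k) i) \<and>
           real (size2 (D k) i) \<le> L1 * mean_size2 (D k) \<and>
           p1 * measure lebesgue F / real (num_psu (D k)) \<le> measure lebesgue (psu (D k) i) \<and>
           measure lebesgue (psu (D k) i) \<le> P1 * measure lebesgue F / real (num_psu (D k)) \<and>
           (\<forall>x\<in>psu (D k) i.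
              c1 / measure lebesgue (psu (D k) i) \<le> dens2 (D k) i x \<and>
              dens2 (D k) i x \<le> C1 / measure lebesgue (psu (D k) i)) \<and>
           2 \<le> size2 (D k) i))"

text \<open>
  Integrability of the fourth power is explicit because the integral of a nonintegrable function
  is 0 by convention, which would make the first bound void.
\<close>

definition VA1 :: "'a::euclidean_space set \<Rightarrow> ('a \<Rightarrow> real) \<Rightarrow> bool" where
  "VA1 F \<rho> \<longleftrightarrow>
     (\<exists>m1 M1. 0 < m1 \<and>
        set_integrable lebesgue F (\<lambda>x. \<rho> x ^ 4) \<and>
        (LINT x:F|lebesgue. \<rho> x ^ 4) / measure lebesgue F \<le> M1 \<and>
        m1 \<le> \<bar>(LINT x:F|lebesgue. \<rho> x) / measure lebesgue F\<bar>)"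

end

theory Submission
  imports Defs
begin

text \<open>
  Write \<open>q\<^sub>i\<close> for the integral of \<open>\<rho>\<^sup>2\<close> over the \<open>i\<close>-th unit, so that the \<open>q\<^sub>i\<close> add up to a
  constant. Cauchy-Schwarz bounds the squared total of the unit by its area times \<open>q\<^sub>i\<close>, and since
  \<open>pi2\<close> is comparable to \<open>size2\<close> divided by the area, the second-stage variance of the unit is at
  most a constant times \<open>q\<^sub>i\<close> times the area divided by \<open>size2\<close>, that is, of order
  \<open>q\<^sub>i / (N n\<^sub>0)\<close> for \<open>N\<close> units of mean second-stage size \<open>n\<^sub>0\<close>. Summing over the units gives
  \<open>V3\<close>; the extra weight \<open>1 / pi1\<close>, of order \<open>N / n\<close> for \<open>n\<close> sampled units, gives \<open>V2\<close>. In
  \<open>V1\<close> the diagonal is treated in the same way with \<open>Delta1 i i \<le> pi1 i\<close>, and the off-diagonal part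
  is at most \<open>max_moment 2\<close> times \<open>(N / n)\<^sup>2\<close> times the square of the integral of \<open>\<bar>\<rho>\<bar>\<close>, up to a
  constant.
\<close>

section \<open>Integration over a set and over a partition\<close>

lemma set_integral_nonneg:
  fixes f :: "'a \<Rightarrow> real"
  assumes "\<And>x. x \<in> S \<Longrightarrow> 0 \<le> f x"
  shows "0 \<le> (LINT x:S|M. f x)"
  unfolding set_lebesgue_integral_def
  by (rule integral_nonneg_AE) (use assms in \<open>auto simp: indicator_def\<close>)

text \<open>The integral of the square of \<open>a * f x - t\<close> is nonnegative; expanding it
  gives \<open>a * (a * q - t\<^sup>2)\<close>, and a positive \<open>a\<close> cancels.\<close>

lemma set_integral_cauchy_schwarz:
  fixes f :: "'a \<Rightarrow> real"
  assumes S: "S \<in> sets M" "emeasure M S < \<infinity>"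
    and f: "set_integrable M S f" and f2: "set_integrable M S (\<lambda>x. (f x)\<^sup>2)"
  shows "(LINT x:S|M. f x)\<^sup>2 \<le> measure M S * (LINT x:S|M. (f x)\<^sup>2)"
proof -
  define t a q where "t = (LINT x:S|M. f x)" and "a = measure M S" and "q = (LINT x:S|M. (f x)\<^sup>2)"
  have c: "set_integrable M S (\<lambda>x. k)" for k :: real
    using S by (simp add: set_integrable_def)
  \<comment> \<open>Scaling \<open>f\<close> by \<open>a\<close>, instead of subtracting the mean
    \<open>t / a\<close>, avoids a division, so the identity also covers
    \<open>a = 0\<close>.\<close>
  have eq: "(LINT x:S|M. (a * f x - t)\<^sup>2) = a * (a * q - t\<^sup>2)"
  proof -
    have "(LINT x:S|M. (a * f x - t)\<^sup>2) = (LINT x:S|M. a\<^sup>2 * (f x)\<^sup>2 - (2 * a * t) * f x + t\<^sup>2)"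
      by (intro arg_cong[where f="set_lebesgue_integral M S"] ext)
        (simp add: power2_diff power_mult_distrib)
    also have "\<dots> = a\<^sup>2 * q - 2 * a * t * t + t\<^sup>2 * a"
      using f f2 c S by (simp add: set_integral_add set_integral_diff t_def a_def q_def)
        (simp add: set_lebesgue_integral_def)
    finally show ?thesis by (simp add: algebra_simps power2_eq_square)
  qed
  have "0 \<le> (LINT x:S|M. (a * f x - t)\<^sup>2)"
    by (intro set_integral_nonneg) auto
  with eq have nn: "0 \<le> a * (a * q - t\<^sup>2)" by simp
  show ?thesis
  proof (cases "a = 0")
    \<comment> \<open>Here \<open>nn\<close> carries no information; instead \<open>S\<close> is a
      null set, which forces \<open>t = 0\<close>.\<close>
    case True
    then have "emeasure M S = 0"
      using S by (simp add: a_def emeasure_eq_ennreal_measure)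
    then have "S \<in> null_sets M" using S by (simp add: null_sets_def)
    then have "AE x in M. x \<notin> S" by (rule AE_not_in)
    then have "t = 0"
      unfolding t_def set_lebesgue_integral_def
      by (intro integral_eq_zero_AE) (auto elim!: eventually_mono)
    with True show ?thesis by (simp add: t_def a_def)
  next
    case False
    then have "0 < a" by (simp add: a_def zero_less_measure_iff)
    with nn show ?thesis by (simp add: zero_le_mult_iff t_def a_def q_def)
  qed
qed

lemma sum_set_integral_partition:
  fixes f :: "'a::euclidean_space \<Rightarrow> real"
  assumes "psu_partition F D" "set_integrable lebesgue F f"
  shows "(\<Sum>i\<in>{1..num_psu D}. LINT x:psu D i|lebesgue. f x) = (LINT x:F|lebesgue. f x)"
proof -
  have "(LINT x:(\<Union>i\<in>{1..num_psu D}. psu D i)|lebesgue. f x)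
      = (\<Sum>i\<in>{1..num_psu D}. LINT x:psu D i|lebesgue. f x)"
    using assms
    by (intro set_integral_finite_Union)
      (auto simp: psu_partition_def intro!: set_integrable_subset[of lebesgue F f])
  then show ?thesis using assms by (simp add: psu_partition_def)
qed

section \<open>Inclusion indicators and their covariances\<close>

lemma measurable_ind1:
  assumes "first_stage D"
  shows "ind1 D i \<in> borel_measurable (prob_sp D)"
proof -
  have "(\<lambda>s. if i \<in> s then 1 else 0 :: real) \<circ> sample1 D \<in> borel_measurable (prob_sp D)"
    using assms by (intro measurable_comp[where N="count_space (Pow {1..num_psu D})"])
      (auto simp: first_stage_def)
  then show ?thesis by (simp add: ind1_def[abs_def] comp_def)
qed

lemma ind1_bounds: "0 \<le> ind1 D i \<omega>" "ind1 D i \<omega> \<le> 1"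
  by (auto simp: ind1_def)

lemma integrable_ind1:
  assumes "first_stage D"
  shows "integrable (prob_sp D) (ind1 D i)"
    and "integrable (prob_sp D) (\<lambda>\<omega>. ind1 D i \<omega> * ind1 D j \<omega>)"
proof -
  interpret prob_space "prob_sp D" using assms by (simp add: first_stage_def)
  note [measurable] = measurable_ind1[OF assms]
  show "integrable (prob_sp D) (ind1 D i)"
    by (rule integrable_const_bound[of _ 1]) (simp_all add: ind1_bounds)
  show "integrable (prob_sp D) (\<lambda>\<omega>. ind1 D i \<omega> * ind1 D j \<omega>)"
    by (rule integrable_const_bound[of _ 1]) (simp_all add: ind1_bounds mult_le_one)
qed

lemma pi1_bounds:
  assumes "first_stage D"
  shows "0 \<le> pi1 D i" "pi1 D i \<le> 1"
proof -
  interpret prob_space "prob_sp D" using assms by (simp add: first_stage_def)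
  show "0 \<le> pi1 D i" by (simp add: pi1_def ind1_def)
  have "(LINT \<omega>|prob_sp D. ind1 D i \<omega>) \<le> (LINT \<omega>|prob_sp D. 1)"
    using integrable_ind1[OF assms] by (intro integral_mono) (auto simp: ind1_bounds)
  then show "pi1 D i \<le> 1" by (simp add: pi1_def prob_space)
qed

text \<open>An indicator is idempotent, so the diagonal entry is the Bernoulli variance
  \<open>pi1 D i * (1 - pi1 D i)\<close>, whose second factor is at most 1.\<close>

lemma abs_Delta1_diag_le:
  assumes "first_stage D"
  shows "\<bar>Delta1 D i i\<bar> \<le> pi1 D i"
proof -
  have "pi1_joint D i i = pi1 D i"
    unfolding pi1_joint_def pi1_def by (intro Bochner_Integration.integral_cong) (auto simp: ind1_def)
  then have "Delta1 D i i = pi1 D i * (1 - pi1 D i)"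
    by (simp add: Delta1_def algebra_simps)
  then show ?thesis
    using pi1_bounds[OF assms, of i] by (simp add: abs_mult mult_left_le)
qed

text \<open>The covariance is the central mixed moment of the pair, and the set
  \<open>{i, j}\<close> is one of those over which the maximum is taken.\<close>

lemma abs_Delta1_off_diag_le:
  assumes fs: "first_stage D" and ij: "i \<in> {1..num_psu D}" "j \<in> {1..num_psu D}" "i \<noteq> j"
  shows "\<bar>Delta1 D i j\<bar> \<le> max_moment D 2"
proof -
  interpret prob_space "prob_sp D" using fs by (simp add: first_stage_def)
  have "(LINT \<omega>|prob_sp D. (\<Prod>l\<in>{i, j}. ind1 D l \<omega> - pi1 D l))
      = (LINT \<omega>|prob_sp D. ind1 D i \<omega> * ind1 D j \<omega> - pi1 D j * ind1 D i \<omega>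
          - pi1 D i * ind1 D j \<omega> + pi1 D i * pi1 D j)"
    using ij by (simp add: algebra_simps)
  also have "\<dots> = Delta1 D i j"
    using integrable_ind1[OF fs] by (simp add: Delta1_def pi1_joint_def pi1_def prob_space)
  finally have "\<bar>Delta1 D i j\<bar> = \<bar>LINT \<omega>|prob_sp D. (\<Prod>l\<in>{i, j}. ind1 D l \<omega> - pi1 D l)\<bar>"
    by simp
  moreover have "finite {J. J \<subseteq> {1..num_psu D} \<and> card J = 2}"
    by (rule finite_subset[of _ "Pow {1..num_psu D}"]) auto
  ultimately show ?thesis
    using ij unfolding max_moment_def
    by (intro Max_ge) (auto simp del: prod.insert intro!: image_eqI[where x="{i, j}"])
qed

lemma max_moment_nonneg: "0 \<le> max_moment D p"
  unfolding max_moment_def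
  by (rule Max_ge) (auto intro!: finite_imageI finite_subset[of _ "Pow {1..num_psu D}"])

text \<open>The diagonal and the off-diagonal part scale differently: on the diagonal one factor
  \<open>pi1 D i\<close> cancels, leaving \<open>1 / p\<close>, whereas off the diagonal both
  weights remain and the smallness must come from \<open>max_moment D 2\<close>.\<close>

lemma abs_V1_le:
  assumes fs: "first_stage D" and "0 < p"
    and p: "\<And>i. i \<in> {1..num_psu D} \<Longrightarrow> p \<le> pi1 D i"
  shows "\<bar>V1 \<rho> D\<bar> \<le> (\<Sum>i\<in>{1..num_psu D}. (tau_psu \<rho> D i)\<^sup>2) / p
      + max_moment D 2 * (\<Sum>i\<in>{1..num_psu D}. \<bar>tau_psu \<rho> D i\<bar>)\<^sup>2 / p\<^sup>2"
proof -
  let ?I = "{1..num_psu D}" and ?t = "tau_psu \<rho> D" and ?m = "max_moment D 2"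
  have m0: "0 \<le> ?m" by (rule max_moment_nonneg)
  \<comment> \<open>One bound serves all pairs. Allowing the moment term on the diagonal too
    completes the double sum to the square of a single sum.\<close>
  have entry: "\<bar>Delta1 D i j * (?t i / pi1 D i) * (?t j / pi1 D j)\<bar>
      \<le> (if j = i then (?t i)\<^sup>2 / p else 0) + ?m / p\<^sup>2 * (\<bar>?t i\<bar> * \<bar>?t j\<bar>)"
    if i: "i \<in> ?I" and j: "j \<in> ?I" for i j
  proof -
    have q: "\<bar>?t l / pi1 D l\<bar> \<le> \<bar>?t l\<bar> / p" if "l \<in> ?I" for l
      using p[OF that] \<open>0 < p\<close> by (simp add: abs_divide frac_le)
    show ?thesis
    proof (cases "i = j")
      case True
      have pos: "0 < pi1 D i" using p[OF i] \<open>0 < p\<close> by simp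
      have "\<bar>Delta1 D i i * (?t i / pi1 D i) * (?t i / pi1 D i)\<bar>
          = \<bar>Delta1 D i i\<bar> * ((?t i)\<^sup>2 / (pi1 D i)\<^sup>2)"
        by (simp add: abs_mult power2_eq_square flip: power2_abs)
      also have "\<dots> \<le> pi1 D i * ((?t i)\<^sup>2 / (pi1 D i)\<^sup>2)"
        by (intro mult_right_mono abs_Delta1_diag_le fs) auto
      also have "\<dots> = (?t i)\<^sup>2 / pi1 D i"
        using pos by (simp add: power2_eq_square)
      also have "\<dots> \<le> (?t i)\<^sup>2 / p"
        using p[OF i] \<open>0 < p\<close> by (intro divide_left_mono) auto
      also have "\<dots> \<le> (?t i)\<^sup>2 / p + ?m / p\<^sup>2 * (\<bar>?t i\<bar> * \<bar>?t i\<bar>)"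
        using m0 by simp
      finally show ?thesis using True by simp
    next
      case False
      have "\<bar>Delta1 D i j * (?t i / pi1 D i) * (?t j / pi1 D j)\<bar>
          = \<bar>Delta1 D i j\<bar> * (\<bar>?t i / pi1 D i\<bar> * \<bar>?t j / pi1 D j\<bar>)"
        by (simp add: abs_mult)
      also have "\<dots> \<le> ?m * ((\<bar>?t i\<bar> / p) * (\<bar>?t j\<bar> / p))"
        using m0 \<open>0 < p\<close> False by (intro mult_mono abs_Delta1_off_diag_le fs i j q) auto
      also have "\<dots> = ?m / p\<^sup>2 * (\<bar>?t i\<bar> * \<bar>?t j\<bar>)"
        by (simp add: power2_eq_square)
      finally show ?thesis using False by simp
    qed
  qed
  have "\<bar>V1 \<rho> D\<bar> \<le> (\<Sum>i\<in>?I. \<Sum>j\<in>?I. \<bar>Delta1 D i j * (?t i / pi1 D i) * (?t j / pi1 D j)\<bar>)"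
    unfolding V1_def by (intro order_trans[OF sum_abs] sum_mono sum_abs)
  also have "\<dots> \<le> (\<Sum>i\<in>?I. \<Sum>j\<in>?I.
      (if j = i then (?t i)\<^sup>2 / p else 0) + ?m / p\<^sup>2 * (\<bar>?t i\<bar> * \<bar>?t j\<bar>))"
    by (intro sum_mono entry)
  also have "\<dots> = (\<Sum>i\<in>?I. (?t i)\<^sup>2) / p + ?m / p\<^sup>2 * ((\<Sum>i\<in>?I. \<bar>?t i\<bar>) * (\<Sum>i\<in>?I. \<bar>?t i\<bar>))"
    unfolding sum_product by (simp add: sum.distrib sum_divide_distrib sum_distrib_left)
  finally show ?thesis by (simp add: power2_eq_square)
qed

section \<open>Second-stage variance of one unit\<close>

lemma V_psu_nonneg:
  assumes "second_stage D" "i \<in> {1..num_psu D}"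
  shows "0 \<le> V_psu \<rho> D i"
  using assms unfolding V_psu_def second_stage_def pi2_def by (intro set_integral_nonneg) auto

text \<open>The density bounds place \<open>pi2 D i x\<close> between \<open>c\<close> and
  \<open>C\<close> times \<open>size2 D i / a i\<close>. The lower one controls the part with
  \<open>\<rho>\<close> and yields \<open>1 / c\<close>; the upper one controls the part with the
  unit total and yields \<open>C\<close>.\<close>

lemma V_psu_le:
  fixes D :: "('w, 'a::euclidean_space) two_stage"
  defines "a i \<equiv> measure lebesgue (psu D i)"
  assumes psu: "psu D i \<in> sets lebesgue" "emeasure lebesgue (psu D i) < \<infinity>" "0 < a i"
    and n: "0 < size2 D i" and c: "0 < c" "0 \<le> C"
    and f: "\<And>x. x \<in> psu D i \<Longrightarrow> c / a i \<le> dens2 D i x"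
      "\<And>x. x \<in> psu D i \<Longrightarrow> dens2 D i x \<le> C / a i"
    and \<rho>: "set_integrable lebesgue (psu D i) \<rho>"
      "set_integrable lebesgue (psu D i) (\<lambda>x. (\<rho> x)\<^sup>2)"
  shows "V_psu \<rho> D i \<le> 2 * (1 / c + C) * (LINT x:psu D i|lebesgue. (\<rho> x)\<^sup>2) * (a i / size2 D i)"
proof -
  let ?S = "psu D i" and ?t = "tau_psu \<rho> D i" and ?q = "LINT x:psu D i|lebesgue. (\<rho> x)\<^sup>2"
  let ?n = "real (size2 D i)"
  have n': "0 < ?n" using n by simp
  let ?g = "\<lambda>x. 2 * a i / (c * ?n) * (\<rho> x)\<^sup>2 + 2 * C * ?t\<^sup>2 / (a i * ?n)"
  have const: "set_integrable lebesgue ?S (\<lambda>x. k)" for k :: real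
    using psu by (simp add: set_integrable_def)
  have bound: "pi2 D i x * (\<rho> x / pi2 D i x - ?t / ?n)\<^sup>2 \<le> ?g x" if x: "x \<in> ?S" for x
  proof -
    have lo: "c * ?n / a i \<le> pi2 D i x" and hi: "pi2 D i x \<le> C * ?n / a i"
      using mult_left_mono[OF f(1)[OF x], of ?n] mult_left_mono[OF f(2)[OF x], of ?n]
      by (simp_all add: pi2_def mult.commute)
    have lopos: "0 < c * ?n / a i" using c psu n' by simp
    then have ppos: "0 < pi2 D i x" using lo by linarith
    \<comment> \<open>The two sides differ by the square of the sum of the two terms.\<close>
    have "(\<rho> x / pi2 D i x - ?t / ?n)\<^sup>2 \<le> 2 * (\<rho> x / pi2 D i x)\<^sup>2 + 2 * (?t / ?n)\<^sup>2"
      using zero_le_power2[of "\<rho> x / pi2 D i x + ?t / ?n"] by (simp only: power2_diff power2_sum)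
    then have "pi2 D i x * (\<rho> x / pi2 D i x - ?t / ?n)\<^sup>2
        \<le> pi2 D i x * (2 * (\<rho> x / pi2 D i x)\<^sup>2 + 2 * (?t / ?n)\<^sup>2)"
      using ppos by (intro mult_left_mono) auto
    also have "\<dots> = 2 * ((\<rho> x)\<^sup>2 / pi2 D i x) + 2 * (pi2 D i x * (?t / ?n)\<^sup>2)"
      using ppos by (simp add: power2_eq_square field_simps)
    also have "\<dots> \<le> 2 * ((\<rho> x)\<^sup>2 / (c * ?n / a i)) + 2 * (C * ?n / a i * (?t / ?n)\<^sup>2)"
      using lo hi lopos ppos
      by (intro add_mono mult_left_mono divide_left_mono mult_right_mono mult_pos_pos) auto
    also have "\<dots> = ?g x"
      using n' psu c by (simp add: power2_eq_square field_simps)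
    finally show ?thesis .
  qed
  \<comment> \<open>Monotonicity in the form that asks for integrability of the upper bound only.\<close>
  have "V_psu \<rho> D i \<le> (LINT x:?S|lebesgue. ?g x)"
    unfolding V_psu_def set_lebesgue_integral_def
  proof (rule integral_mono')
    show "integrable lebesgue (\<lambda>x. indicat_real ?S x *\<^sub>R ?g x)"
      unfolding set_integrable_def[symmetric] using \<rho> const by (intro set_integral_add) auto
    show "indicat_real ?S x *\<^sub>R (pi2 D i x * (\<rho> x / pi2 D i x - ?t / ?n)\<^sup>2)
        \<le> indicat_real ?S x *\<^sub>R ?g x" for x
      using bound[of x] by (cases "x \<in> ?S") auto
    show "0 \<le> indicat_real ?S x *\<^sub>R ?g x" for x
      using c n' psu by (auto simp: indicator_def)
  qed
  also have "\<dots> = 2 * a i / (c * ?n) * ?q + 2 * C * ?t\<^sup>2 / (a i * ?n) * a i"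
    using \<rho> const psu
    by (subst set_integral_add) (auto simp: a_def set_lebesgue_integral_def)
  also have "\<dots> = 2 * a i / (c * ?n) * ?q + 2 * C / ?n * ?t\<^sup>2"
    using psu by simp
  \<comment> \<open>Cauchy-Schwarz trades the squared total for \<open>a i * ?q\<close>, which
    brings both summands to the order \<open>?q * a i / ?n\<close>.\<close>
  also have "\<dots> \<le> 2 * a i / (c * ?n) * ?q + 2 * C / ?n * (a i * ?q)"
    using set_integral_cauchy_schwarz[OF psu(1,2) \<rho>] c
    by (intro add_left_mono mult_left_mono) (auto simp: a_def tau_psu_def)
  also have "\<dots> = 2 * (1 / c + C) * ?q * (a i / ?n)"
    using c n' by (simp add: field_simps)
  finally show ?thesis .
qed

section \<open>Explicit bounds for a single design\<close>

text \<open>The numerators involve only \<open>F\<close>, \<open>\<rho>\<close> and the constants of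
  the assumptions, hence stay the same for every member of a sequence of designs.\<close>

lemma design_bounds:
  fixes D :: "('w, 'a::euclidean_space) two_stage" and F :: "'a set" and \<rho> :: "'a \<Rightarrow> real"
  defines "A \<equiv> measure lebesgue F" and "N \<equiv> real (num_psu D)" and "n \<equiv> real (size1 D)"
    and "Q \<equiv> LINT x:F|lebesgue. (\<rho> x)\<^sup>2" and "T \<equiv> LINT x:F|lebesgue. \<bar>\<rho> x\<bar>"
  assumes F: "emeasure lebesgue F < \<infinity>" "0 < A"
    and \<rho>: "set_integrable lebesgue F \<rho>" "set_integrable lebesgue F (\<lambda>x. (\<rho> x)\<^sup>2)"
    and D: "psu_partition F D" "first_stage D" "second_stage D"
    and pos: "0 < N" "0 < n"
    and const: "0 < c" "0 < l" "0 < p" "0 \<le> P" "0 < d" "0 \<le> C"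
    and pi1: "\<And>i. i \<in> {1..num_psu D} \<Longrightarrow> c \<le> N / n * pi1 D i"
    and moment: "max_moment D 2 \<le> K * n / N\<^sup>2"
    and size2: "\<And>i. i \<in> {1..num_psu D} \<Longrightarrow> l * mean_size2 D \<le> size2 D i \<and> 0 < size2 D i"
    and area: "\<And>i. i \<in> {1..num_psu D} \<Longrightarrow> p * A / N \<le> measure lebesgue (psu D i)"
      "\<And>i. i \<in> {1..num_psu D} \<Longrightarrow> measure lebesgue (psu D i) \<le> P * A / N"
    and dens2: "\<And>i x. i \<in> {1..num_psu D} \<Longrightarrow> x \<in> psu D i \<Longrightarrow>
      d / measure lebesgue (psu D i) \<le> dens2 D i x \<and> dens2 D i x \<le> C / measure lebesgue (psu D i)"
  shows "\<bar>V1 \<rho> D\<bar> \<le> (P * A * Q / c + K * T\<^sup>2 / c\<^sup>2) / n"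
    and "\<bar>V2 \<rho> D\<bar> \<le> 2 * (1 / d + C) * (P * A / l) * Q / c / (n * mean_size2 D)"
    and "\<bar>V3 \<rho> D\<bar> \<le> 2 * (1 / d + C) * (P * A / l) * Q / (N * mean_size2 D)"
proof -
  let ?I = "{1..num_psu D}"
  let ?q = "\<lambda>i. LINT x:psu D i|lebesgue. (\<rho> x)\<^sup>2"
  \<comment> \<open>The factor of \<open>?q i\<close> in the bound for \<open>V_psu\<close>: an area
    of at most \<open>P * A / N\<close> is divided by a size of at least
    \<open>l * mean_size2 D\<close>.\<close>
  let ?B = "2 * (1 / d + C) * (P * A / l) / (N * mean_size2 D)"
  have mean_pos: "0 < mean_size2 D"
    using pos size2 unfolding mean_size2_def N_def by (intro divide_pos_pos sum_pos) auto
  have sub: "psu D i \<subseteq> F" and meas: "psu D i \<in> sets lebesgue" if "i \<in> ?I" for i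
    using D(1) that by (auto simp: psu_partition_def)
  have "F \<in> sets lebesgue"
  proof -
    have "(\<Union>i\<in>?I. psu D i) \<in> sets lebesgue" using meas by (intro sets.finite_UN) auto
    then show ?thesis using D(1) by (simp add: psu_partition_def)
  qed
  have fin: "emeasure lebesgue (psu D i) < \<infinity>" if "i \<in> ?I" for i
    using emeasure_mono[OF sub[OF that] \<open>F \<in> sets lebesgue\<close>] F(1) by (rule le_less_trans)
  have int: "set_integrable lebesgue (psu D i) \<rho>" "set_integrable lebesgue (psu D i) (\<lambda>x. (\<rho> x)\<^sup>2)"
    if "i \<in> ?I" for i
    using \<rho> sub[OF that] meas[OF that] by (auto intro: set_integrable_subset)
  have q0: "0 \<le> ?q i" for i by (intro set_integral_nonneg) auto
  have sumQ: "(\<Sum>i\<in>?I. ?q i) = Q"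
    unfolding Q_def by (rule sum_set_integral_partition[OF D(1) \<rho>(2)])
  have pi_lo: "c * n / N \<le> pi1 D i" if "i \<in> ?I" for i
    using pi1[OF that] pos by (simp add: field_simps)
  have cn: "0 < c * n / N" using pos const by simp

  have "(\<Sum>i\<in>?I. (tau_psu \<rho> D i)\<^sup>2) \<le> (\<Sum>i\<in>?I. P * A / N * ?q i)"
  proof (rule sum_mono)
    fix i assume i: "i \<in> ?I"
    have "(tau_psu \<rho> D i)\<^sup>2 \<le> measure lebesgue (psu D i) * ?q i"
      unfolding tau_psu_def by (rule set_integral_cauchy_schwarz[OF meas[OF i] fin[OF i] int[OF i]])
    also have "\<dots> \<le> P * A / N * ?q i" by (intro mult_right_mono area(2) i q0)
    finally show "(tau_psu \<rho> D i)\<^sup>2 \<le> P * A / N * ?q i" .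
  qed
  also have "\<dots> = P * A / N * Q" using sumQ by (simp only: sum_distrib_left [symmetric])
  finally have sum_tau2: "(\<Sum>i\<in>?I. (tau_psu \<rho> D i)\<^sup>2) \<le> P * A / N * Q" .

  have abs_int: "set_integrable lebesgue F (\<lambda>x. \<bar>\<rho> x\<bar>)"
    using set_integrable_abs[OF \<rho>(1)] by simp
  have "(\<Sum>i\<in>?I. \<bar>tau_psu \<rho> D i\<bar>) \<le> (\<Sum>i\<in>?I. LINT x:psu D i|lebesgue. \<bar>\<rho> x\<bar>)"
    unfolding tau_psu_def using set_integral_norm_bound[OF int(1)] by (intro sum_mono) auto
  also have "\<dots> = T" unfolding T_def by (rule sum_set_integral_partition[OF D(1) abs_int])
  finally have sum_tau: "(\<Sum>i\<in>?I. \<bar>tau_psu \<rho> D i\<bar>) \<le> T" .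

  have "\<bar>V1 \<rho> D\<bar> \<le> (\<Sum>i\<in>?I. (tau_psu \<rho> D i)\<^sup>2) / (c * n / N)
      + max_moment D 2 * (\<Sum>i\<in>?I. \<bar>tau_psu \<rho> D i\<bar>)\<^sup>2 / (c * n / N)\<^sup>2"
    by (rule abs_V1_le[OF D(2) cn pi_lo])
  \<comment> \<open>In the second term \<open>n / N\<^sup>2\<close> divided by
    \<open>(n / N)\<^sup>2\<close> leaves \<open>1 / n\<close>. The sign of \<open>K\<close> is not
    given; nonnegativity of \<open>K * n / N\<^sup>2\<close> follows from that of
    \<open>max_moment\<close>.\<close>
  also have "\<dots> \<le> (P * A / N * Q) / (c * n / N) + (K * n / N\<^sup>2) * T\<^sup>2 / (c * n / N)\<^sup>2"
    using cn sum_tau sum_tau2 order_trans[OF max_moment_nonneg moment]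
    by (intro add_mono divide_right_mono mult_mono power_mono moment) (auto intro: sum_nonneg)
  also have "\<dots> = (P * A * Q / c + K * T\<^sup>2 / c\<^sup>2) / n"
    using pos const by (simp add: field_simps power2_eq_square)
  finally show "\<bar>V1 \<rho> D\<bar> \<le> (P * A * Q / c + K * T\<^sup>2 / c\<^sup>2) / n" .

  have V_lo: "0 \<le> V_psu \<rho> D i" if "i \<in> ?I" for i by (rule V_psu_nonneg[OF D(3) that])
  have V_hi: "V_psu \<rho> D i \<le> ?B * ?q i" if i: "i \<in> ?I" for i
  proof -
    have apos: "0 < measure lebesgue (psu D i)"
      using area(1)[OF i] pos const F(2) by (intro less_le_trans[OF _ area(1)[OF i]]) simp
    have "measure lebesgue (psu D i) / size2 D i \<le> (P * A / N) / (l * mean_size2 D)"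
      using size2[OF i] area(2)[OF i] const mean_pos apos by (intro frac_le) auto
    then have "2 * (1 / d + C) * ?q i * (measure lebesgue (psu D i) / size2 D i)
        \<le> 2 * (1 / d + C) * ?q i * ((P * A / N) / (l * mean_size2 D))"
      using q0 const by (intro mult_left_mono) auto
    moreover have "V_psu \<rho> D i \<le> 2 * (1 / d + C) * ?q i * (measure lebesgue (psu D i) / size2 D i)"
      using size2[OF i] dens2[OF i] const
      by (intro V_psu_le meas fin int i apos) auto
    ultimately show ?thesis by (simp add: mult_ac)
  qed
  have V3_lo: "0 \<le> V3 \<rho> D" unfolding V3_def by (intro sum_nonneg V_lo)
  have "V3 \<rho> D \<le> (\<Sum>i\<in>?I. ?B * ?q i)" unfolding V3_def by (intro sum_mono V_hi)
  also have "\<dots> = ?B * Q" using sumQ by (simp only: sum_distrib_left [symmetric])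
  finally have V3_hi: "V3 \<rho> D \<le> ?B * Q" .
  then show "\<bar>V3 \<rho> D\<bar> \<le> 2 * (1 / d + C) * (P * A / l) * Q / (N * mean_size2 D)"
    using V3_lo by (simp add: mult_ac)

  \<comment> \<open>The weights in \<open>V2\<close> are at most \<open>N / (c * n)\<close>, so
    \<open>V2\<close> reduces to \<open>V3\<close>, and this \<open>N\<close> cancels the one in
    \<open>?B\<close>.\<close>
  have w: "0 \<le> (1 - pi1 D i) / pi1 D i" "(1 - pi1 D i) / pi1 D i \<le> 1 / (c * n / N)"
    if "i \<in> ?I" for i
    using pi1_bounds[OF D(2), of i] pi_lo[OF that] cn by (simp, intro frac_le) auto
  have "0 \<le> V2 \<rho> D" unfolding V2_def by (intro sum_nonneg mult_nonneg_nonneg w V_lo)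
  moreover have "V2 \<rho> D \<le> (\<Sum>i\<in>?I. 1 / (c * n / N) * V_psu \<rho> D i)"
    unfolding V2_def by (intro sum_mono mult_right_mono w V_lo)
  then have "V2 \<rho> D \<le> 1 / (c * n / N) * V3 \<rho> D"
    by (simp only: V3_def sum_distrib_left)
  moreover have "1 / (c * n / N) * V3 \<rho> D \<le> 1 / (c * n / N) * (?B * Q)"
    using cn by (intro mult_left_mono V3_hi) (rule divide_nonneg_pos, auto)
  moreover have "1 / (c * n / N) * (?B * Q) = 2 * (1 / d + C) * (P * A / l) * Q / c / (n * mean_size2 D)"
    using pos by (simp add: mult_ac)
  ultimately show "\<bar>V2 \<rho> D\<bar> \<le> 2 * (1 / d + C) * (P * A / l) * Q / c / (n * mean_size2 D)"
    by linarith
qed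

section \<open>Passage to the asymptotic sequence\<close>

text \<open>Meant for \<open>a\<close> the squared measure of \<open>F\<close>: being fixed and
  nonzero, it is absorbed into the constant.\<close>

lemma bigo_of_abs_le_const_divide:
  fixes f g :: "nat \<Rightarrow> real"
  assumes "eventually (\<lambda>k. \<bar>f k\<bar> \<le> M / g k) sequentially"
    and "eventually (\<lambda>k. 0 < g k) sequentially" and "a \<noteq> 0"
  shows "f \<in> O(\<lambda>k. a / g k)"
proof (rule bigoI[of _ "M / \<bar>a\<bar>"])
  show "eventually (\<lambda>k. norm (f k) \<le> M / \<bar>a\<bar> * norm (a / g k)) sequentially"
    using assms(1,2) by eventually_elim (use \<open>a \<noteq> 0\<close> in simp)
qed

theorem proposition1:
  fixes F :: "'a::euclidean_space set"
    and \<rho> :: "'a \<Rightarrow> real"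
    and D :: "nat \<Rightarrow> ('w, 'a) two_stage"
  assumes "bounded F" and "F \<in> sets lebesgue" and "measure lebesgue F > 0"
    and "set_integrable lebesgue F \<rho>"
    and "asymptotic_sequence F D"
    and "FS1 D" and "FS2 D" and "SS1 F D" and "VA1 F \<rho>"
  shows "(\<lambda>k. V1 \<rho> (D k)) \<in> O(\<lambda>k. (measure lebesgue F)\<^sup>2 / real (size1 (D k))) \<and>
    (\<lambda>k. V2 \<rho> (D k)) \<in>
      O(\<lambda>k. (measure lebesgue F)\<^sup>2 / (real (size1 (D k)) * mean_size2 (D k))) \<and>
    (\<lambda>k. V3 \<rho> (D k)) \<in>
      O(\<lambda>k. (measure lebesgue F)\<^sup>2 / (real (num_psu (D k)) * mean_size2 (D k)))"
proof -
  let ?A = "measure lebesgue F"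
  let ?Q = "LINT x:F|lebesgue. (\<rho> x)\<^sup>2" and ?T = "LINT x:F|lebesgue. \<bar>\<rho> x\<bar>"
  have finF: "emeasure lebesgue F < \<infinity>"
    using bounded_set_imp_lmeasurable[OF assms(1,2)] by (auto simp only: fmeasurable_def)
  have \<rho>4: "set_integrable lebesgue F (\<lambda>x. \<rho> x ^ 4)" using assms(9) by (auto simp: VA1_def)
  \<comment> \<open>The dominating function \<open>1 + \<rho> x ^ 4\<close> is integrable because
    \<open>F\<close> has finite measure.\<close>
  have \<rho>2: "set_integrable lebesgue F (\<lambda>x. (\<rho> x)\<^sup>2)"
  proof (rule set_integrable_bound)
    show "set_integrable lebesgue F (\<lambda>x. 1 + \<rho> x ^ 4)"
      using \<rho>4 finF assms(2) by (intro set_integral_add) (auto simp: set_integrable_def)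
    \<comment> \<open>Measurability of \<open>\<rho>\<close> is known only after multiplication by
      the indicator of \<open>F\<close>, which equals its own square.\<close>
    have "set_borel_measurable lebesgue F \<rho>"
      using assms(4) by (auto simp: set_integrable_def set_borel_measurable_def)
    then have "(\<lambda>x. (indicat_real F x *\<^sub>R \<rho> x)\<^sup>2) \<in> borel_measurable lebesgue"
      unfolding set_borel_measurable_def by (rule borel_measurable_power)
    moreover have "(\<lambda>x. (indicat_real F x *\<^sub>R \<rho> x)\<^sup>2) = (\<lambda>x. indicat_real F x *\<^sub>R (\<rho> x)\<^sup>2)"
      by (auto simp: indicator_def)
    ultimately show "set_borel_measurable lebesgue F (\<lambda>x. (\<rho> x)\<^sup>2)"
      by (simp add: set_borel_measurable_def)
    have "(\<rho> x)\<^sup>2 \<le> 1 + \<rho> x ^ 4" for x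
    proof -
      have "0 \<le> ((\<rho> x)\<^sup>2 - 1)\<^sup>2 + (\<rho> x)\<^sup>2" by simp
      also have "\<dots> = 1 + \<rho> x ^ 4 - (\<rho> x)\<^sup>2"
        by (simp add: power2_diff flip: power_mult)
      finally show ?thesis by simp
    qed
    then show "AE x in lebesgue. x \<in> F \<longrightarrow> norm ((\<rho> x)\<^sup>2) \<le> norm (1 + \<rho> x ^ 4)"
      by simp
  qed
  obtain c where c: "0 < c" "\<And>k i. i \<in> {1..num_psu (D k)} \<Longrightarrow>
      c \<le> real (num_psu (D k)) / real (size1 (D k)) * pi1 (D k) i"
    using assms(6) unfolding FS1_def by metis
  obtain K where K: "\<And>k. max_moment (D k) 2 \<le> K * real (size1 (D k)) / real (num_psu (D k)) ^ 2"
    using assms(7) unfolding FS2_def by metis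
  obtain l p P d C where lpPdC: "0 < l" "0 < p" "p \<le> P" "0 < d" "d \<le> C"
    and SS: "\<And>k i. i \<in> {1..num_psu (D k)} \<Longrightarrow>
        l * mean_size2 (D k) \<le> real (size2 (D k) i) \<and>
        p * ?A / real (num_psu (D k)) \<le> measure lebesgue (psu (D k) i) \<and>
        measure lebesgue (psu (D k) i) \<le> P * ?A / real (num_psu (D k)) \<and>
        (\<forall>x\<in>psu (D k) i. d / measure lebesgue (psu (D k) i) \<le> dens2 (D k) i x \<and>
           dens2 (D k) i x \<le> C / measure lebesgue (psu (D k) i)) \<and> 2 \<le> size2 (D k) i"
    using assms(8) unfolding SS1_def by metis
  have seq: "psu_partition F (D k)" "first_stage (D k)" "second_stage (D k)" for k
    using assms(5) by (auto simp: asymptotic_sequence_def)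
  \<comment> \<open>Both counts tend to infinity. Their positivity makes the quotients genuine,
    since division by zero would return 0.\<close>
  have evN: "eventually (\<lambda>k. 0 < num_psu (D k)) sequentially"
    and evn: "eventually (\<lambda>k. 0 < size1 (D k)) sequentially"
    using assms(5) eventually_compose_filterlim[OF eventually_gt_at_top[of "0::nat"]]
    by (auto simp: asymptotic_sequence_def)
  have mean_pos: "0 < mean_size2 (D k)" if "0 < num_psu (D k)" for k
    unfolding mean_size2_def
  proof (intro divide_pos_pos sum_pos)
    show "0 < real (size2 (D k) i)" if "i \<in> {1..num_psu (D k)}" for i
      using SS[OF that] by simp
  qed (use that in auto)
  have "0 \<le> P" "0 \<le> C" using lpPdC by auto
  \<comment> \<open>The two gaps are the positivity of the counts, supplied for each large
    \<open>k\<close>; the premises on sizes, areas and densities that stay open come from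
    \<open>SS\<close>.\<close>
  note bounds = design_bounds[OF finF assms(3,4) \<rho>2 seq _ _ c(1) lpPdC(1,2) \<open>0 \<le> P\<close> lpPdC(4)
    \<open>0 \<le> C\<close> c(2) K]
  have a0: "?A\<^sup>2 \<noteq> 0" using assms(3) by simp
  show ?thesis
  proof (intro conjI)
    show "(\<lambda>k. V1 \<rho> (D k)) \<in> O(\<lambda>k. ?A\<^sup>2 / real (size1 (D k)))"
    proof (rule bigo_of_abs_le_const_divide[OF _ _ a0])
      show "eventually (\<lambda>k. \<bar>V1 \<rho> (D k)\<bar> \<le> (P * ?A * ?Q / c + K * ?T\<^sup>2 / c\<^sup>2) / real (size1 (D k)))
          sequentially"
        using evN evn
      proof eventually_elim
        case (elim k)
        then show ?case by (intro bounds(1)) (use SS[where k=k] in force)+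
      qed
    qed (use evn in simp)
    show "(\<lambda>k. V2 \<rho> (D k)) \<in> O(\<lambda>k. ?A\<^sup>2 / (real (size1 (D k)) * mean_size2 (D k)))"
    proof (rule bigo_of_abs_le_const_divide[OF _ _ a0])
      show "eventually (\<lambda>k. \<bar>V2 \<rho> (D k)\<bar> \<le> 2 * (1 / d + C) * (P * ?A / l) * ?Q / c
          / (real (size1 (D k)) * mean_size2 (D k))) sequentially"
        using evN evn
      proof eventually_elim
        case (elim k)
        then show ?case by (intro bounds(2)) (use SS[where k=k] in force)+
      qed
      show "eventually (\<lambda>k. 0 < real (size1 (D k)) * mean_size2 (D k)) sequentially"
        using evN evn by eventually_elim (simp add: mean_pos)
    qed
    show "(\<lambda>k. V3 \<rho> (D k)) \<in> O(\<lambda>k. ?A\<^sup>2 / (real (num_psu (D k)) * mean_size2 (D k)))"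
    proof (rule bigo_of_abs_le_const_divide[OF _ _ a0])
      show "eventually (\<lambda>k. \<bar>V3 \<rho> (D k)\<bar> \<le> 2 * (1 / d + C) * (P * ?A / l) * ?Q
          / (real (num_psu (D k)) * mean_size2 (D k))) sequentially"
        using evN evn
      proof eventually_elim
        case (elim k)
        then show ?case by (intro bounds(3)) (use SS[where k=k] in force)+
      qed
      show "eventually (\<lambda>k. 0 < real (num_psu (D k)) * mean_size2 (D k)) sequentially"
        using evN by eventually_elim (simp add: mean_pos)
    qed
  qed
qed

end
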